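(* Let $G=(V,E)$ be an arbitrary finite network in which every node has at least one neighbor, let $\sigma\in(0,1)$, and let $(B_v(t))_{v\in V}$, $t\ge 0$, be a solution of the Type I dynamics with threshold $\sigma$ on $G$, i.e. of $$\frac{d}{dt}B_v(t)=f\Big(\frac{1}{\deg(v)}\sum_{u\in N_v}B_u(t)\Big)-B_v(t),\quad v\in V,\qquad f(x)=\begin{cases}1&x>\sigma\\ 0&x<\sigma\\ 1/2&x=\sigma,\end{cases}$$ with values $B_v(t)\in[0,1]$. If $\frac{1}{\deg(v)}\sum_{u\in N_v}B_u(0)>\sigma$ for all $v\in V$, then $\lim_{t\to\infty}B_v(t)=1$ for all $v\in V$. If $\frac{1}{\deg(v)}\sum_{u\in N_v}B_u(0)<\sigma$ for all $v\in V$, then $\lim_{t\to\infty}B_v(t)=0$ for all $v\in V$.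
   Context: $G=(V,E)$ is a finite graph (undirected or directed) without self-loops, $N_v=\{u\in V:(u,v)\in E\}$ is the set of (in-)neighbors of $v$, and $\deg(v)=|N_v|$. $B_v(t)\in[0,1]$ represents the probability that node $v$ is secure ("blue") at time $t$. A solution is a family of absolutely continuous functions $B_v:[0,\infty)\to[0,1]$ satisfying the differential equation for almost every $t\ge0$ (with prescribed initial values $B_v(0)\in[0,1]$). *)

theory Defs
  imports "HOL-Analysis.Analysis" "Graph_Theory.Pair_Digraph"
begin

text \<open>
  Undirected networks are the digraphs with a symmetric arc set
  (\<^const>\<open>Digraph.symmetric\<close>), for which in-neighbors are simply neighbors.
\<close>

definition in_neighbors :: "'a pair_pre_digraph \<Rightarrow> 'a \<Rightarrow> 'a set" where
  "in_neighbors G v = {u \<in> pverts G. (u, v) \<in> parcs G}"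

definition neighbor_avg :: "'a pair_pre_digraph \<Rightarrow> ('a \<Rightarrow> real) \<Rightarrow> 'a \<Rightarrow> real" where
  "neighbor_avg G x v = (1 / real (card (in_neighbors G v))) * (\<Sum>u\<in>in_neighbors G v. x u)"

definition threshold_fun :: "real \<Rightarrow> real \<Rightarrow> real" where
  "threshold_fun \<sigma> x = (if x > \<sigma> then 1 else if x < \<sigma> then 0 else 1/2)"

text \<open>
  The usual \<open>\<epsilon>\<close>-\<open>\<delta>\<close> notion of absolute continuity of a real function on an interval; the library's
  \<^const>\<open>absolutely_continuous\<close> is about measures.
\<close>

definition abs_continuous_on :: "real set \<Rightarrow> (real \<Rightarrow> real) \<Rightarrow> bool" where
  "abs_continuous_on S f \<longleftrightarrow>
    (\<forall>\<epsilon>>0. \<exists>\<delta>>0. \<forall>(n::nat) a b.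
      (\<forall>i<n. a i \<le> b i \<and> {a i..b i} \<subseteq> S) \<longrightarrow>
      disjoint_family_on (\<lambda>i. {a i<..<b i}) {..<n} \<longrightarrow>
      (\<Sum>i<n. b i - a i) < \<delta> \<longrightarrow>
      (\<Sum>i<n. \<bar>f (b i) - f (a i)\<bar>) < \<epsilon>)"

text \<open>
  Only the restriction of each \<open>B v\<close> to \<open>t \<ge> 0\<close> matters, hence the derivative within \<open>{0..}\<close>.
\<close>

definition type_I_solution ::
  "'a pair_pre_digraph \<Rightarrow> real \<Rightarrow> ('a \<Rightarrow> real \<Rightarrow> real) \<Rightarrow> bool" where
  "type_I_solution G \<sigma> B \<longleftrightarrow>
    (\<forall>v\<in>pverts G.
      (\<forall>t\<ge>0. B v t \<in> {0..1}) \<and>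
      abs_continuous_on {0..} (B v) \<and>
      (AE t in lebesgue. t \<ge> 0 \<longrightarrow>
        (B v has_real_derivative
          (threshold_fun \<sigma> (neighbor_avg G (\<lambda>u. B u t) v) - B v t)) (at t within {0..})))"

end

theory Submission
  imports Defs
begin

text \<open>As long as all neighbor averages exceed \<open>\<sigma>\<close>, the equation reads B' =
  1 - B almost everywhere, so no B_v decreases, and hence no average does either. An average that
  starts above \<open>\<sigma>\<close> can therefore never come down to it
  (\<open>neighbor_avg_stays_above\<close>). So every B_v is nondecreasing for all time, and it
  cannot stay at or below 1 - \<epsilon>: its slope would be at least \<epsilon> forever, and it
  would leave [0,1] (\<open>type_I_tendsto_1\<close>). The case below \<open>\<sigma>\<close> is the
  same statement for 1 - B with threshold 1 - \<open>\<sigma>\<close>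
  (\<open>type_I_solution_reflect\<close>).

  The analytic input is that a derivative bound valid almost everywhere controls increments of an
  absolutely continuous function (\<open>abs_continuous_on_increment_ge\<close>). It is proved by a
  gauge argument: a fine tagged division splits into intervals tagged at good points, where the
  derivative bound applies, and intervals inside an open set of small measure around the exceptional
  points, where absolute continuity applies.\<close>

section \<open>Absolute continuity on an interval\<close>

lemma abs_continuous_on_subset:
  assumes "abs_continuous_on S f" and "T \<subseteq> S"
  shows "abs_continuous_on T f"
  unfolding abs_continuous_on_def
proof (intro allI impI)
  fix \<epsilon> :: real
  assume "\<epsilon> > 0"
  then obtain \<delta> where "\<delta> > 0" and \<delta>: "\<forall>(n::nat) a b.
      (\<forall>i<n. a i \<le> b i \<and> {a i..b i} \<subseteq> S) \<longrightarrow>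
      disjoint_family_on (\<lambda>i. {a i<..<b i}) {..<n} \<longrightarrow>
      (\<Sum>i<n. b i - a i) < \<delta> \<longrightarrow> (\<Sum>i<n. \<bar>f (b i) - f (a i)\<bar>) < \<epsilon>"
    using assms(1) unfolding abs_continuous_on_def by blast
  show "\<exists>\<delta>>0. \<forall>(n::nat) a b.
      (\<forall>i<n. a i \<le> b i \<and> {a i..b i} \<subseteq> T) \<longrightarrow>
      disjoint_family_on (\<lambda>i. {a i<..<b i}) {..<n} \<longrightarrow>
      (\<Sum>i<n. b i - a i) < \<delta> \<longrightarrow> (\<Sum>i<n. \<bar>f (b i) - f (a i)\<bar>) < \<epsilon>"
  proof (intro exI conjI allI impI)
    fix n :: nat and a b :: "nat \<Rightarrow> real"
    assume T: "\<forall>i<n. a i \<le> b i \<and> {a i..b i} \<subseteq> T"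
      and n: "disjoint_family_on (\<lambda>i. {a i<..<b i}) {..<n}" "(\<Sum>i<n. b i - a i) < \<delta>"
    have "a i \<le> b i \<and> {a i..b i} \<subseteq> S" if "i < n" for i
      using T assms(2) that by blast
    then show "(\<Sum>i<n. \<bar>f (b i) - f (a i)\<bar>) < \<epsilon>"
      using n by (rule \<delta>[rule_format])
  qed fact
qed

text \<open>Enumerating the index set reduces this to the definition. The intervals of a tagged
  division are indexed by tag-interval pairs rather than by an initial segment of the
  naturals.\<close>

lemma abs_continuous_on_finite_family:
  assumes "abs_continuous_on S f" and "\<epsilon> > 0"
  obtains \<delta> where "\<delta> > 0" and "\<forall>I a b. finite I \<longrightarrow>
      (\<forall>i\<in>I. a i \<le> b i \<and> {a i..b i} \<subseteq> S) \<longrightarrow>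
      disjoint_family_on (\<lambda>i. {a i<..<b i}) I \<longrightarrow>
      (\<Sum>i\<in>I. b i - a i) < \<delta> \<longrightarrow> (\<Sum>i\<in>I. \<bar>f (b i) - f (a i)\<bar>) < \<epsilon>"
proof -
  obtain \<delta> where "\<delta> > 0" and \<delta>: "\<forall>(n::nat) a b.
      (\<forall>i<n. a i \<le> b i \<and> {a i..b i} \<subseteq> S) \<longrightarrow>
      disjoint_family_on (\<lambda>i. {a i<..<b i}) {..<n} \<longrightarrow>
      (\<Sum>i<n. b i - a i) < \<delta> \<longrightarrow> (\<Sum>i<n. \<bar>f (b i) - f (a i)\<bar>) < \<epsilon>"
    using assms unfolding abs_continuous_on_def by blast
  show thesis
  proof (rule that[OF \<open>\<delta> > 0\<close>], intro allI impI)
    fix I :: "'b set" and a b :: "'b \<Rightarrow> real"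
    assume I: "finite I" "\<forall>i\<in>I. a i \<le> b i \<and> {a i..b i} \<subseteq> S"
      "disjoint_family_on (\<lambda>i. {a i<..<b i}) I" "(\<Sum>i\<in>I. b i - a i) < \<delta>"
    obtain h where h: "bij_betw h {..<card I} I"
      using ex_bij_betw_nat_finite[OF I(1)] by (auto simp: atLeast0LessThan)
    have "(\<Sum>k<card I. \<bar>f (b (h k)) - f (a (h k))\<bar>) < \<epsilon>"
    proof (rule \<delta>[rule_format])
      show "a (h k) \<le> b (h k) \<and> {a (h k)..b (h k)} \<subseteq> S" if "k < card I" for k
        using I(2) bij_betwE[OF h] that by blast
      show "disjoint_family_on (\<lambda>k. {a (h k)<..<b (h k)}) {..<card I}"
        unfolding disjoint_family_on_def
      proof (intro ballI impI)
        fix j k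
        assume "j \<in> {..<card I}" "k \<in> {..<card I}" "j \<noteq> k"
        then have "h j \<in> I" "h k \<in> I" "h j \<noteq> h k"
          using h by (auto simp: bij_betw_def inj_on_def)
        then show "{a (h j)<..<b (h j)} \<inter> {a (h k)<..<b (h k)} = {}"
          using I(3) unfolding disjoint_family_on_def by blast
      qed
      show "(\<Sum>k<card I. b (h k) - a (h k)) < \<delta>"
        using I(4) sum.reindex_bij_betw[OF h, of "\<lambda>i. b i - a i"] by simp
    qed
    then show "(\<Sum>i\<in>I. \<bar>f (b i) - f (a i)\<bar>) < \<epsilon>"
      using sum.reindex_bij_betw[OF h, of "\<lambda>i. \<bar>f (b i) - f (a i)\<bar>"] by simp
  qed
qed

text \<open>Absolute continuity for a family of one interval is uniform continuity; \<open>S\<close>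
  being an interval puts the whole segment between two of its points into \<open>S\<close>.\<close>

lemma abs_continuous_on_imp_continuous_on:
  assumes "abs_continuous_on S f" and "is_interval S"
  shows "continuous_on S f"
  unfolding continuous_on_iff
proof (intro ballI allI impI)
  fix x \<epsilon> :: real
  assume "x \<in> S" "\<epsilon> > 0"
  obtain \<delta> where "\<delta> > 0" and \<delta>: "\<forall>(I::unit set) a b. finite I \<longrightarrow>
      (\<forall>i\<in>I. a i \<le> b i \<and> {a i..b i} \<subseteq> S) \<longrightarrow>
      disjoint_family_on (\<lambda>i. {a i<..<b i}) I \<longrightarrow>
      (\<Sum>i\<in>I. b i - a i) < \<delta> \<longrightarrow> (\<Sum>i\<in>I. \<bar>f (b i) - f (a i)\<bar>) < \<epsilon>"
    using abs_continuous_on_finite_family[OF assms(1) \<open>\<epsilon> > 0\<close>] .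
  have *: "\<bar>f v - f u\<bar> < \<epsilon>" if "u \<in> S" "v \<in> S" "u \<le> v" "v - u < \<delta>" for u v
  proof -
    have "{u..v} \<subseteq> S"
      using that assms(2) by (meson atLeastAtMost_iff mem_is_interval_1_I subsetI)
    then have "(\<Sum>i\<in>{()}. \<bar>f v - f u\<bar>) < \<epsilon>"
      using that by (intro \<delta>[rule_format, of "{()}" "\<lambda>_. u" "\<lambda>_. v"])
        (auto simp: disjoint_family_on_def)
    then show ?thesis
      by simp
  qed
  have "dist (f y) (f x) < \<epsilon>" if "y \<in> S" "dist y x < \<delta>" for y
    using *[of x y] *[of y x] that \<open>x \<in> S\<close>
    by (cases "x \<le> y") (auto simp: dist_real_def abs_minus_commute)
  then show "\<exists>d>0. \<forall>y\<in>S. dist y x < d \<longrightarrow> dist (f y) (f x) < \<epsilon>"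
    using \<open>\<delta> > 0\<close> by blast
qed

section \<open>Increments from almost-everywhere derivative bounds\<close>

text \<open>Outer regularity of Lebesgue measure: \<open>U - N\<close> is small, and adding the null
  set \<open>N\<close> back does not change the measure.\<close>

lemma null_set_open_superset:
  assumes "N \<in> null_sets lebesgue" and "\<delta> > 0"
  obtains U where "open U" "N \<subseteq> U" "U \<in> lmeasurable" "measure lebesgue U < \<delta>"
proof -
  have N: "N \<in> sets lebesgue" "emeasure lebesgue N = 0"
    using assms(1) by auto
  obtain U where U: "open U" "N \<subseteq> U" "U - N \<in> lmeasurable" "emeasure lebesgue (U - N) < ennreal \<delta>"
    using sets_lebesgue_outer_open[OF N(1) assms(2)] .
  have "U = (U - N) \<union> N"
    using U by blast
  then have em: "emeasure lebesgue U = emeasure lebesgue (U - N)"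
    using emeasure_Un_null_set[of "U - N" lebesgue N] U(3) assms(1) by (auto simp: fmeasurable_def)
  have "U \<in> lmeasurable"
    using em U \<open>U = (U - N) \<union> N\<close> N(1) fmeasurableD2[OF U(3)]
    by (metis fmeasurableD fmeasurableI infinity_ennreal_def less_top sets.Un)
  moreover have "measure lebesgue U < \<delta>"
  proof -
    have "ennreal (measure lebesgue U) < ennreal \<delta>"
      using U(4) em emeasure_eq_measure2[OF \<open>U \<in> lmeasurable\<close>] by simp
    then show ?thesis
      by (simp add: ennreal_less_iff)
  qed
  ultimately show thesis
    using that U by blast
qed

text \<open>
  In a fine tagged division the intervals tagged in the null set are contained in an open set of
  small measure, so absolute continuity makes their contribution to \<^term>\<open>f b - f a\<close> negligible.
\<close>

lemma abs_continuous_on_increment_ge: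
  fixes f :: "real \<Rightarrow> real"
  assumes "a \<le> b" and ac: "abs_continuous_on {a..b} f"
    and der: "AE t in lebesgue. t \<in> {a<..<b} \<longrightarrow>
      (\<exists>D\<ge>c. (f has_real_derivative D) (at t within {a..b}))"
  shows "c * (b - a) \<le> f b - f a"
proof (rule field_le_epsilon)
  fix e :: real
  assume "e > 0"
  \<comment> \<open>Three errors will add up to \<open>e\<close>:
    \<open>\<epsilon> * (b - a)\<close> from the good intervals, \<open>\<epsilon>\<close> from the
    increments over the bad ones, and \<open>\<epsilon>\<close> from the length that the bad ones
    take away.\<close>
  define \<epsilon> where "\<epsilon> = e / (b - a + 2)"
  have "\<epsilon> > 0"
    using \<open>e > 0\<close> \<open>a \<le> b\<close> by (simp add: \<epsilon>_def)
  obtain \<delta> where "\<delta> > 0" and \<delta>: "\<forall>(I::(real \<times> real set) set) u v. finite I \<longrightarrow>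
      (\<forall>i\<in>I. u i \<le> v i \<and> {u i..v i} \<subseteq> {a..b}) \<longrightarrow>
      disjoint_family_on (\<lambda>i. {u i<..<v i}) I \<longrightarrow>
      (\<Sum>i\<in>I. v i - u i) < \<delta> \<longrightarrow> (\<Sum>i\<in>I. \<bar>f (v i) - f (u i)\<bar>) < \<epsilon>"
    using abs_continuous_on_finite_family[OF ac \<open>\<epsilon> > 0\<close>] .
  obtain N where N_sub: "{t \<in> space lebesgue. \<not> (t \<in> {a<..<b} \<longrightarrow>
      (\<exists>D\<ge>c. (f has_real_derivative D) (at t within {a..b})))} \<subseteq> N"
    and "emeasure lebesgue N = 0" "N \<in> sets lebesgue"
    using AE_E[OF der] .
  then have N: "N \<in> null_sets lebesgue"
    by auto
  \<comment> \<open>The derivative bound is assumed only in the open interval, so the endpoints join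
    the exceptional set.\<close>
  have N': "N \<union> {a, b} \<in> null_sets lebesgue"
    using N by (simp add: negligible_iff_null_sets[symmetric])
  \<comment> \<open>The first bound feeds absolute continuity; the second makes \<open>c\<close>
    times the lost length at most \<open>\<epsilon>\<close>. The summand 1 keeps the divisor
    positive when \<open>c\<close> is 0.\<close>
  define \<eta> where "\<eta> = min \<delta> (\<epsilon> / (\<bar>c\<bar> + 1))"
  have "\<eta> > 0"
    using \<open>\<delta> > 0\<close> \<open>\<epsilon> > 0\<close> by (simp add: \<eta>_def)
  obtain U where U: "open U" "N \<union> {a, b} \<subseteq> U" "U \<in> lmeasurable" "measure lebesgue U < \<eta>"
    using null_set_open_superset[OF N' \<open>\<eta> > 0\<close>] .
  \<comment> \<open>Straddle estimate: as \<open>u\<close> and \<open>v\<close> lie on opposite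
    sides of \<open>x\<close>, the linearization errors at the two ends add up to at most
    \<open>\<epsilon> * (v - u)\<close>.\<close>
  have "\<exists>d>0. \<forall>u v. u \<in> {a..b} \<longrightarrow> v \<in> {a..b} \<longrightarrow> u \<le> x \<longrightarrow> x \<le> v \<longrightarrow> {u..v} \<subseteq> ball x d \<longrightarrow>
      (c - \<epsilon>) * (v - u) \<le> f v - f u" if "x \<in> {a..b} - U" for x
  proof -
    have "x \<notin> N" "x \<noteq> a" "x \<noteq> b" "a \<le> x" "x \<le> b" "x \<in> space lebesgue"
      using that U(2) by auto
    moreover from this have "x \<in> {a<..<b}"
      by simp
    ultimately obtain D where "D \<ge> c" and D: "(f has_real_derivative D) (at x within {a..b})"
      using N_sub by blast
    obtain d where "d > 0" and d: "\<And>y. y \<in> {a..b} \<Longrightarrow> \<bar>y - x\<bar> < d \<Longrightarrow>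
        \<bar>f y - f x - D * (y - x)\<bar> \<le> \<epsilon> * \<bar>y - x\<bar>"
      using D \<open>\<epsilon> > 0\<close> unfolding has_field_derivative_def has_derivative_within_alt
      by (auto simp: mult.commute)
    have "(c - \<epsilon>) * (v - u) \<le> f v - f u"
      if "u \<in> {a..b}" "v \<in> {a..b}" "u \<le> x" "x \<le> v" "{u..v} \<subseteq> ball x d" for u v
    proof -
      have "u \<in> {u..v}" "v \<in> {u..v}"
        using that by auto
      then have "u \<in> ball x d" "v \<in> ball x d"
        using that(5) by blast+
      then have "\<bar>u - x\<bar> < d" "\<bar>v - x\<bar> < d"
        by (auto simp: dist_real_def)
      then have "f v - f x \<ge> D * (v - x) - \<epsilon> * (v - x)" "f u - f x \<le> D * (u - x) + \<epsilon> * (x - u)"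
        using d[of u] d[of v] that by (auto simp: abs_le_iff)
      then have "f v - f u \<ge> (D - \<epsilon>) * (v - u)"
        by (simp add: algebra_simps)
      moreover have "(D - \<epsilon>) * (v - u) \<ge> (c - \<epsilon>) * (v - u)"
        using \<open>D \<ge> c\<close> that by (intro mult_right_mono) auto
      ultimately show ?thesis
        by linarith
    qed
    with \<open>d > 0\<close> show ?thesis
      by blast
  qed
  then obtain d where d: "\<And>x. x \<in> {a..b} - U \<Longrightarrow> d x > 0"
    "\<And>x u v. x \<in> {a..b} - U \<Longrightarrow> u \<in> {a..b} \<Longrightarrow> v \<in> {a..b} \<Longrightarrow> u \<le> x \<Longrightarrow> x \<le> v \<Longrightarrow>
       {u..v} \<subseteq> ball x (d x) \<Longrightarrow> (c - \<epsilon>) * (v - u) \<le> f v - f u"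
    by metis
  \<comment> \<open>An interval tagged in \<open>U\<close> is forced to lie inside \<open>U\<close>,
    and one tagged at a good point is short enough for the straddle estimate. The value
    \<open>UNIV\<close> only makes the gauge total, since tags lie in \<open>{a..b}\<close>.\<close>
  define \<gamma> where "\<gamma> x = (if x \<in> U then U else if x \<in> {a..b} then ball x (d x) else UNIV)" for x
  have "gauge \<gamma>"
    using U(1) d(1) by (auto simp: gauge_def \<gamma>_def)
  then obtain p where p: "p tagged_division_of {a..b}" "\<gamma> fine p"
    by (rule fine_division_exists_real)
  define lo hi where "lo = (\<lambda>i::real \<times> real set. Inf (snd i))"
    and "hi = (\<lambda>i::real \<times> real set. Sup (snd i))"
  have p_itv: "snd i = {lo i..hi i} \<and> lo i \<le> fst i \<and> fst i \<le> hi i \<and> a \<le> lo i \<and> hi i \<le> b"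
    if "i \<in> p" for i
  proof -
    obtain x K where i: "i = (x, K)"
      by fastforce
    then have "(x, K) \<in> p"
      using that by simp
    note K = tagged_division_ofD(2-4)[OF p(1) this]
    obtain u v where uv: "K = {u..v}"
      using K(3) by (auto simp: cbox_interval)
    then have "u \<le> x" "x \<le> v" "a \<le> u" "v \<le> b"
      using K(1,2) by auto
    then show ?thesis
      by (simp add: i uv lo_def hi_def)
  qed
  have p_fin: "finite p"
    using tagged_division_ofD(1)[OF p(1)] .
  have p_disj: "disjoint_family_on (\<lambda>i. {lo i<..<hi i}) p"
    unfolding disjoint_family_on_def
  proof (intro ballI impI)
    fix i j
    assume ij: "i \<in> p" "j \<in> p" "i \<noteq> j"
    then have "interior (snd i) \<inter> interior (snd j) = {}"
      using tagged_division_ofD(5)[OF p(1), of "fst i" "snd i" "fst j" "snd j"]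
      by (simp add: prod_eq_iff)
    then show "{lo i<..<hi i} \<inter> {lo j<..<hi j} = {}"
      using p_itv ij by (metis interior_atLeastAtMost_real)
  qed
  \<comment> \<open>The bad intervals, where no derivative bound is available.\<close>
  define q where "q = {i \<in> p. fst i \<in> U}"
  have q: "finite q" "q \<subseteq> p"
    using p_fin by (auto simp: q_def)
  have q_disj: "disjoint_family_on (\<lambda>i. {lo i<..<hi i}) q"
    using disjoint_family_on_mono[OF q(2) p_disj] .
  have finite_length: "emeasure lebesgue {s<..<t} \<noteq> \<infinity>" for s t :: real
    using fmeasurableD2[OF lmeasurable_box[of s t]] by simp
  \<comment> \<open>The open interiors are disjoint subsets of \<open>U\<close>, so their lengths
    add up to at most its measure.\<close>
  have len_q: "(\<Sum>i\<in>q. hi i - lo i) < \<eta>"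
  proof -
    have "(\<Sum>i\<in>q. hi i - lo i) = (\<Sum>i\<in>q. measure lebesgue {lo i<..<hi i})"
      using p_itv q(2) by (intro sum.cong) force+
    also have "\<dots> = measure lebesgue (\<Union>i\<in>q. {lo i<..<hi i})"
      by (rule measure_finite_Union[OF q(1) _ q_disj, symmetric])
        (use finite_length in auto)
    also have "\<dots> \<le> measure lebesgue U"
    proof (rule measure_mono_fmeasurable[OF _ _ U(3)])
      show "(\<Union>i\<in>q. {lo i<..<hi i}) \<subseteq> U"
      proof safe
        fix x' x K y
        assume xK: "(x, K) \<in> q" and y: "y \<in> {lo (x, K)<..<hi (x, K)}"
        have "K \<subseteq> \<gamma> x" "x \<in> U"
          using p(2) xK by (auto simp: fine_def q_def)
        moreover have "K = {lo (x, K)..hi (x, K)}"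
          using p_itv xK q(2) by fastforce
        ultimately show "y \<in> U"
          using y by (auto simp: \<gamma>_def)
      qed
      show "(\<Union>i\<in>q. {lo i<..<hi i}) \<in> sets lebesgue"
        using q(1) by (intro sets.finite_UN) auto
    qed
    finally show ?thesis
      using U(4) by simp
  qed
  have "(\<Sum>i\<in>q. \<bar>f (hi i) - f (lo i)\<bar>) < \<epsilon>"
    using len_q p_itv q by (intro \<delta>[rule_format] q_disj) (force simp: \<eta>_def)+
  then have "- \<epsilon> \<le> (\<Sum>i\<in>q. f (hi i) - f (lo i))"
    using sum_abs[of "\<lambda>i. f (hi i) - f (lo i)" q] by linarith
  moreover have "(\<Sum>i\<in>p - q. (c - \<epsilon>) * (hi i - lo i)) \<le> (\<Sum>i\<in>p - q. f (hi i) - f (lo i))"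
  proof (rule sum_mono)
    fix i
    assume i: "i \<in> p - q"
    have "fst i \<in> {a..b} - U"
      using i p_itv[of i] by (auto simp: q_def)
    moreover have "snd i \<subseteq> \<gamma> (fst i)"
      using p(2) i by (metis DiffD1 fineD prod.collapse)
    then have "{lo i..hi i} \<subseteq> ball (fst i) (d (fst i))"
      using i p_itv[of i] calculation by (simp add: \<gamma>_def)
    ultimately show "(c - \<epsilon>) * (hi i - lo i) \<le> f (hi i) - f (lo i)"
      using i p_itv[of i] by (intro d(2)[of "fst i"]) auto
  qed
  moreover have "(\<Sum>i\<in>p. f (hi i) - f (lo i)) = f b - f a"
    using additive_tagged_division_1[OF \<open>a \<le> b\<close> p(1), of f]
    by (simp add: lo_def hi_def case_prod_beta)
  moreover have len_p: "(\<Sum>i\<in>p. hi i - lo i) = b - a"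
    using additive_tagged_division_1[OF \<open>a \<le> b\<close> p(1), of "\<lambda>x. x"]
    by (simp add: lo_def hi_def case_prod_beta)
  moreover have "(\<Sum>i\<in>p - q. g i) = (\<Sum>i\<in>p. g i) - (\<Sum>i\<in>q. g i)" for g :: "_ \<Rightarrow> real"
    using sum_diff[OF p_fin q(2)] .
  \<comment> \<open>The increments over \<open>p\<close> telescope to \<open>f b - f a\<close>,
    while the good intervals have total length \<open>b - a\<close> minus that of the bad
    ones.\<close>
  ultimately have main: "f b - f a \<ge> (c - \<epsilon>) * (b - a - (\<Sum>i\<in>q. hi i - lo i)) - \<epsilon>"
    by (simp add: sum_distrib_left[symmetric])
  have len_q0: "0 \<le> (\<Sum>i\<in>q. hi i - lo i)"
    using p_itv q(2) by (intro sum_nonneg) force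
  have "c * (\<Sum>i\<in>q. hi i - lo i) \<le> (\<bar>c\<bar> + 1) * \<eta>"
    using len_q len_q0 \<open>\<eta> > 0\<close> by (intro mult_mono) auto
  also have "\<dots> \<le> (\<bar>c\<bar> + 1) * (\<epsilon> / (\<bar>c\<bar> + 1))"
    by (intro mult_left_mono) (auto simp: \<eta>_def)
  also have "\<dots> = \<epsilon>"
    by (simp add: field_simps)
  finally have "c * (\<Sum>i\<in>q. hi i - lo i) \<le> \<epsilon>" .
  moreover have "0 \<le> \<epsilon> * (\<Sum>i\<in>q. hi i - lo i)"
    using \<open>\<epsilon> > 0\<close> len_q0 by simp
  ultimately have "f b - f a \<ge> c * (b - a) - \<epsilon> * (b - a) - \<epsilon> - \<epsilon>"
    using main by (simp add: algebra_simps)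
  moreover have "\<epsilon> * (b - a + 2) = e"
    using \<open>a \<le> b\<close> by (simp add: \<epsilon>_def)
  ultimately show "c * (b - a) \<le> f b - f a + e"
    by (simp add: distrib_left)
qed

section \<open>Persistence above the threshold and convergence to 1\<close>

lemma type_I_solutionD:
  assumes "type_I_solution G \<sigma> B" and "v \<in> pverts G"
  shows "\<And>t. t \<ge> 0 \<Longrightarrow> 0 \<le> B v t \<and> B v t \<le> 1"
    and "abs_continuous_on {0..} (B v)"
    and "AE t in lebesgue. t \<ge> 0 \<longrightarrow>
        (B v has_real_derivative
          (threshold_fun \<sigma> (neighbor_avg G (\<lambda>u. B u t) v) - B v t)) (at t within {0..})"
  using assms unfolding type_I_solution_def by auto

lemma neighbor_avg_mono:
  assumes "\<And>u. u \<in> pverts G \<Longrightarrow> x u \<le> y u"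
  shows "neighbor_avg G x v \<le> neighbor_avg G y v"
  unfolding neighbor_avg_def
  by (intro mult_left_mono sum_mono) (auto simp: assms in_neighbors_def)

lemma continuous_on_neighbor_avg:
  assumes "\<And>u. u \<in> pverts G \<Longrightarrow> continuous_on S (B u)"
  shows "continuous_on S (\<lambda>t. neighbor_avg G (\<lambda>u. B u t) v)"
  unfolding neighbor_avg_def
  by (intro continuous_intros assms) (auto simp: in_neighbors_def)

text \<open>The average of the constant 1 is 1 precisely because there is a neighbor; over an empty
  neighborhood \<open>neighbor_avg\<close> is 0.\<close>

lemma neighbor_avg_one_minus:
  assumes "finite (pverts G)" and "in_neighbors G v \<noteq> {}"
  shows "neighbor_avg G (\<lambda>u. 1 - x u) v = 1 - neighbor_avg G x v"
proof -
  have "finite (in_neighbors G v)"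
    using assms(1) by (auto simp: in_neighbors_def)
  then have "card (in_neighbors G v) > 0"
    using assms(2) by (simp add: card_gt_0_iff)
  then show ?thesis
    by (simp add: neighbor_avg_def sum_subtractf field_simps)
qed

text \<open>Above the threshold the derivative is \<open>1 - B v t\<close>, which is at least
  \<open>c\<close>. Both conditions concern interior times only, so \<open>b\<close> may be the very
  time at which an average first reaches \<open>\<sigma>\<close>.\<close>

lemma type_I_increment_ge:
  assumes sol: "type_I_solution G \<sigma> B" and "v \<in> pverts G" and "0 \<le> a" and "a \<le> b"
    and above: "\<And>t. a < t \<Longrightarrow> t < b \<Longrightarrow> neighbor_avg G (\<lambda>u. B u t) v > \<sigma>"
    and gap: "\<And>t. a < t \<Longrightarrow> t < b \<Longrightarrow> B v t \<le> 1 - c"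
  shows "c * (b - a) \<le> B v b - B v a"
proof (rule abs_continuous_on_increment_ge[OF \<open>a \<le> b\<close>])
  note D = type_I_solutionD[OF sol \<open>v \<in> pverts G\<close>]
  show "abs_continuous_on {a..b} (B v)"
    using abs_continuous_on_subset[OF D(2)] \<open>0 \<le> a\<close> by auto
  show "AE t in lebesgue. t \<in> {a<..<b} \<longrightarrow>
      (\<exists>D\<ge>c. (B v has_real_derivative D) (at t within {a..b}))"
    using D(3)
  proof eventually_elim
    case (elim t)
    show ?case
    proof
      assume t: "t \<in> {a<..<b}"
      then have "(B v has_real_derivative 1 - B v t) (at t within {0..})"
        using elim above[of t] \<open>0 \<le> a\<close> by (auto simp: threshold_fun_def)
      then have "(B v has_real_derivative 1 - B v t) (at t within {a..b})"
        by (rule DERIV_subset) (use \<open>0 \<le> a\<close> in auto)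
      then show "\<exists>D\<ge>c. (B v has_real_derivative D) (at t within {a..b})"
        using gap[of t] t by (intro exI[of _ "1 - B v t"]) auto
    qed
  qed
qed

text \<open>
  At the first time some average is at most \<open>\<sigma>\<close>, every node has so far only increased; hence so
  has that average, which started above \<open>\<sigma>\<close>.
\<close>

lemma neighbor_avg_stays_above:
  assumes fin: "finite (pverts G)" and sol: "type_I_solution G \<sigma> B"
    and init: "\<And>v. v \<in> pverts G \<Longrightarrow> neighbor_avg G (\<lambda>u. B u 0) v > \<sigma>"
    and "v \<in> pverts G" and "t \<ge> 0"
  shows "neighbor_avg G (\<lambda>u. B u t) v > \<sigma>"
proof (rule ccontr)
  assume neg: "\<not> ?thesis"
  \<comment> \<open>The failure times of all nodes together. Finiteness of the vertex set and
    continuity make \<open>Z\<close> closed, so its infimum is attained: there is a first failure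
    time.\<close>
  define Z where "Z = (\<Union>w\<in>pverts G. {s \<in> {0..}. neighbor_avg G (\<lambda>u. B u s) w \<le> \<sigma>})"
  have "continuous_on {0..} (B u)" if "u \<in> pverts G" for u
    using abs_continuous_on_imp_continuous_on[OF type_I_solutionD(2)[OF sol that]]
    by (simp add: is_interval_ci)
  then have "closed Z"
    unfolding Z_def using fin
    by (intro closed_UN ballI continuous_on_closed_Collect_le continuous_on_neighbor_avg
        continuous_on_const) auto
  have "t \<in> Z"
    using neg \<open>v \<in> pverts G\<close> \<open>t \<ge> 0\<close> by (auto simp: Z_def not_less)
  have bdd: "bdd_below Z"
    by (auto simp: Z_def bdd_below_def)
  define T where "T = Inf Z"
  have "T \<in> Z"
    unfolding T_def using \<open>t \<in> Z\<close> bdd \<open>closed Z\<close> by (intro closed_contains_Inf) auto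
  then obtain w where w: "w \<in> pverts G" "neighbor_avg G (\<lambda>u. B u T) w \<le> \<sigma>" and "T \<ge> 0"
    by (auto simp: Z_def)
  have above: "neighbor_avg G (\<lambda>u. B u s) u > \<sigma>" if "u \<in> pverts G" "0 < s" "s < T" for u s
  proof (rule ccontr)
    assume "\<not> ?thesis"
    then have "s \<in> Z"
      using that by (auto simp: Z_def not_less)
    then show False
      using cInf_lower[OF _ bdd] \<open>s < T\<close> by (force simp: T_def)
  qed
  \<comment> \<open>Slope bound \<open>c = 0\<close>, available because \<open>B u\<close> never
    exceeds 1.\<close>
  have "B u 0 \<le> B u T" if "u \<in> pverts G" for u
    using type_I_increment_ge[OF sol that _ \<open>T \<ge> 0\<close>, of 0] above[OF that]
      type_I_solutionD(1)[OF sol that] by auto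
  then have "neighbor_avg G (\<lambda>u. B u 0) w \<le> neighbor_avg G (\<lambda>u. B u T) w"
    by (rule neighbor_avg_mono)
  with init[OF w(1)] w(2) show False
    by simp
qed

lemma type_I_tendsto_1:
  assumes fin: "finite (pverts G)" and sol: "type_I_solution G \<sigma> B"
    and init: "\<And>v. v \<in> pverts G \<Longrightarrow> neighbor_avg G (\<lambda>u. B u 0) v > \<sigma>"
    and v: "v \<in> pverts G"
  shows "(B v \<longlongrightarrow> 1) at_top"
proof -
  note range = type_I_solutionD(1)[OF sol v]
  note above = neighbor_avg_stays_above[OF fin sol init v]
  have mono: "B v s \<le> B v t" if "0 \<le> s" "s \<le> t" for s t
    using type_I_increment_ge[OF sol v that, of 0] above range that by auto
  have "\<exists>s\<ge>0. B v s > 1 - \<epsilon>" if "\<epsilon> > 0" for \<epsilon> :: real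
  proof (rule ccontr)
    assume "\<not> ?thesis"
    \<comment> \<open>Slope at least \<open>\<epsilon>\<close> for a time
      \<open>2 / \<epsilon>\<close> means a rise of 2, impossible within [0,1].\<close>
    then have "\<epsilon> * (2 / \<epsilon> - 0) \<le> B v (2 / \<epsilon>) - B v 0"
      using \<open>\<epsilon> > 0\<close> above by (intro type_I_increment_ge[OF sol v]) (auto simp: not_less)
    then show False
      using range[of "2 / \<epsilon>"] range[of 0] \<open>\<epsilon> > 0\<close> by auto
  qed
  note close = this
  show ?thesis
  proof (rule tendstoI)
    fix \<epsilon> :: real
    assume "\<epsilon> > 0"
    then obtain s where s: "s \<ge> 0" "B v s > 1 - \<epsilon>"
      using close by blast
    show "\<forall>\<^sub>F t in at_top. dist (B v t) 1 < \<epsilon>"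
      using eventually_ge_at_top[of s]
    proof eventually_elim
      case (elim t)
      then show ?case
        using mono[of s t] range[of t] s by (auto simp: dist_real_def)
    qed
  qed
qed

section \<open>Reflection and the case below the threshold\<close>

lemma abs_continuous_on_one_minus:
  assumes "abs_continuous_on S f"
  shows "abs_continuous_on S (\<lambda>x. 1 - f x)"
  using assms by (simp add: abs_continuous_on_def abs_minus_commute)

text \<open>The threshold function is symmetric under this exchange, also at the threshold itself,
  since its value there is 1/2. Nonempty neighborhoods let averaging commute with the
  reflection.\<close>

lemma type_I_solution_reflect:
  assumes fin: "finite (pverts G)" and nb: "\<And>v. v \<in> pverts G \<Longrightarrow> in_neighbors G v \<noteq> {}"
    and sol: "type_I_solution G \<sigma> B"
  shows "type_I_solution G (1 - \<sigma>) (\<lambda>v t. 1 - B v t)"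
  unfolding type_I_solution_def
proof (intro ballI conjI)
  fix v
  assume v: "v \<in> pverts G"
  note D = type_I_solutionD[OF sol v]
  show "\<forall>t\<ge>0. 1 - B v t \<in> {0..1}"
    using D(1) by auto
  show "abs_continuous_on {0..} (\<lambda>t. 1 - B v t)"
    using abs_continuous_on_one_minus[OF D(2)] .
  have thr: "threshold_fun (1 - \<sigma>) (1 - x) = 1 - threshold_fun \<sigma> x" for x
    by (auto simp: threshold_fun_def)
  show "AE t in lebesgue. t \<ge> 0 \<longrightarrow>
      ((\<lambda>t. 1 - B v t) has_real_derivative
        (threshold_fun (1 - \<sigma>) (neighbor_avg G (\<lambda>u. 1 - B u t) v) - (1 - B v t)))
        (at t within {0..})"
    using D(3)
    by eventually_elim
      (auto simp: neighbor_avg_one_minus[OF fin nb[OF v]] thr intro!: derivative_eq_intros)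
qed

theorem theorem1:
  fixes G :: "'a pair_pre_digraph" and \<sigma> :: real and B :: "'a \<Rightarrow> real \<Rightarrow> real"
  assumes "pair_digraph G"
    and "\<forall>v\<in>pverts G. in_neighbors G v \<noteq> {}"
    and "0 < \<sigma>" and "\<sigma> < 1"
    and "type_I_solution G \<sigma> B"
  shows "((\<forall>v\<in>pverts G. neighbor_avg G (\<lambda>u. B u 0) v > \<sigma>) \<longrightarrow>
            (\<forall>v\<in>pverts G. (B v \<longlongrightarrow> 1) at_top)) \<and>
         ((\<forall>v\<in>pverts G. neighbor_avg G (\<lambda>u. B u 0) v < \<sigma>) \<longrightarrow>
            (\<forall>v\<in>pverts G. (B v \<longlongrightarrow> 0) at_top))"
proof -
  interpret pair_digraph G
    by fact
  note fin = pair_finite_verts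
  have refl: "type_I_solution G (1 - \<sigma>) (\<lambda>v t. 1 - B v t)"
    using assms by (intro type_I_solution_reflect fin) auto
  show ?thesis
  proof (intro conjI impI ballI)
    fix v
    assume "\<forall>v\<in>pverts G. neighbor_avg G (\<lambda>u. B u 0) v > \<sigma>" "v \<in> pverts G"
    then show "(B v \<longlongrightarrow> 1) at_top"
      using type_I_tendsto_1[OF fin assms(5)] by blast
  next
    fix v
    assume low: "\<forall>v\<in>pverts G. neighbor_avg G (\<lambda>u. B u 0) v < \<sigma>" and v: "v \<in> pverts G"
    \<comment> \<open>Averages of \<open>B\<close> below \<open>\<sigma>\<close> are averages of the
      reflected solution above \<open>1 - \<sigma>\<close>.\<close>
    have "((\<lambda>t. 1 - B v t) \<longlongrightarrow> 1) at_top"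
      using type_I_tendsto_1[OF fin refl _ v] low assms(2) by (auto simp: neighbor_avg_one_minus[OF fin])
    then have "((\<lambda>t. 1 - (1 - B v t)) \<longlongrightarrow> 1 - 1) at_top"
      by (intro tendsto_intros)
    then show "(B v \<longlongrightarrow> 0) at_top"
      by simp
  qed
qed

end
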